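(* Two polynomials $P(X), Q(X)\in\mathbb{N}[X]$ are combinatorially equivalent if and only if they are algebraically equivalent. That is, there is a very explicit bijection from $P(T)$ to $Q(T)$, where $T$ is the set of all finite binary trees, if and only if $P(X)=Q(X)$ holds in the semiring $\mathbb{N}[X]/(X=1+X^2)$.
   Context: Semiring. $\mathbb{N}[X]$ is the commutative semiring (with $0$ and $1$) of polynomials with non-negative integer coefficients, and $\mathbb{N}[X]/(X=1+X^2)$ is its quotient by the smallest semiring congruence identifying $X$ with $1+X^2$. Polynomials $P(X),Q(X)\in\mathbb{N}[X]$ are algebraically equivalent if they have the same image in $\mathbb{N}[X]/(X=1+X^2)$. Trees. A tree is a finite binary tree in which the immediate successors (children) of any node are labeled left and right; each node has at most one left child and at most one right child, and even an only child is designated as left or right. The empty tree, denoted $0$, is allowed. Write $[t_1,t_2]$ for the tree consisting of a root with left subtree $t_1$ and right subtree $t_2$; every tree is either $0$ or uniquely of the form $[t_1,t_2]$. A leaf is a node with no children. $T$ is the set of all trees (up to isomorphism). The set $P(T)$. If $P(X)=\sum_k c_kX^k$, then $P(T)$ is the set of tagged $k$-tuples of trees $(t_1,\dots,t_k,\tau)$, where $k$ ranges over the (finite) set of exponents in the sum defining $P(X)$ and the tag $\tau$ is an integer with $1\le\tau\le c_k$. Its elements are called $P$-tuples. Patterns. A pattern is a tree in which some (possibly none) of the leaves are labeled with distinct symbols (unrelated to the left/right designation of children). A $P$-pattern is a tagged $k$-tuple of patterns $(r_1,\dots,r_k,\tau)$, with $k$ and $\tau$ in the same ranges as for $P$-tuples,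 in which all the labels (across all components) are distinct. A substitution assigns a tree (possibly $0$) to each label; the instance of a pattern or $P$-pattern under a substitution is obtained by replacing every labeled leaf by the tree assigned to its label (removing the leaf if that tree is $0$), leaving unlabeled nodes and the tag unchanged. Thus instances of $P$-patterns are $P$-tuples. Very explicit functions. A very explicit function $f:P(T)\to Q(T)$ is one given by a finite indexed family $(\vec p_i)_{i\in I}$ of $P$-patterns and a family $(\vec q_i)_{i\in I}$ of $Q$-patterns indexed by the same $I$ such that, for each $i\in I$, the same labels occur in $\vec p_i$ as in $\vec q_i$, and such that every element $\vec t$ of $P(T)$ is an instance of a unique $\vec p_i$ under a unique substitution; $f(\vec t)$ is then the result of applying the same substitution to $\vec q_i$ for the same $i$. A very explicit bijection is a very explicit function that is a bijection. $P(X)$ and $Q(X)$ are combinatorially equivalent if there is a very explicit bijection from $P(T)$ to $Q(T)$. *)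

theory Defs
  imports "HOL-Computational_Algebra.Polynomial"
begin

section \<open>The semiring \<open>\<nat>[X]/(X = 1 + X\<^sup>2)\<close>\<close>

text \<open>The smallest semiring congruence on \<open>\<nat>[X]\<close> identifying \<open>X\<close> with \<open>1 + X\<^sup>2\<close>.\<close>

inductive tree_cong :: "nat poly \<Rightarrow> nat poly \<Rightarrow> bool" where
  gen: "tree_cong [:0, 1:] (1 + [:0, 1:]\<^sup>2)"
| refl: "tree_cong p p"
| sym: "tree_cong p q \<Longrightarrow> tree_cong q p"
| trans: "tree_cong p q \<Longrightarrow> tree_cong q r \<Longrightarrow> tree_cong p r"
| add: "tree_cong p p' \<Longrightarrow> tree_cong q q' \<Longrightarrow> tree_cong (p + q) (p' + q')"
| mult: "tree_cong p p' \<Longrightarrow> tree_cong q q' \<Longrightarrow> tree_cong (p * q) (p' * q')"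

lemma tree_cong_zero_iff: "tree_cong p q \<Longrightarrow> p = 0 \<longleftrightarrow> q = 0"
proof (induction rule: tree_cong.induct)
  case gen
  show ?case by (simp add: power2_eq_square one_pCons)
next
  case (add p p' q q')
  have "a + b = 0 \<longleftrightarrow> a = 0 \<and> b = 0" for a b :: "nat poly"
    by (auto simp: poly_eq_iff)
  with add show ?case by simp
qed auto

lifting_forget poly.lifting

quotient_type tree_semiring = "nat poly" / tree_cong
  by (intro equivpI reflpI sympI transpI) (blast intro: tree_cong.intros)+

instantiation tree_semiring :: comm_semiring_1
begin

lift_definition zero_tree_semiring :: tree_semiring is 0 .
lift_definition one_tree_semiring :: tree_semiring is 1 .
lift_definition plus_tree_semiring :: "tree_semiring \<Rightarrow> tree_semiring \<Rightarrow> tree_semiring"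
  is "(+)" by (rule tree_cong.add)
lift_definition times_tree_semiring :: "tree_semiring \<Rightarrow> tree_semiring \<Rightarrow> tree_semiring"
  is "(*)" by (rule tree_cong.mult)

instance
proof
  show "(0::tree_semiring) \<noteq> 1"
    by transfer (use tree_cong_zero_iff[of 0 1] in auto)
qed (transfer; simp add: algebra_simps tree_cong.refl)+

end

definition residue_class :: "nat poly \<Rightarrow> tree_semiring" where
  "residue_class = abs_tree_semiring"

lemma residue_class_hom:
  "residue_class 0 = 0"
  "residue_class 1 = 1"
  "residue_class (p + q) = residue_class p + residue_class q"
  "residue_class (p * q) = residue_class p * residue_class q"
  by (simp_all add: residue_class_def zero_tree_semiring_def one_tree_semiring_def
      plus_tree_semiring.abs_eq times_tree_semiring.abs_eq)

definition algebraically_equivalent :: "nat poly \<Rightarrow> nat poly \<Rightarrow> bool" where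
  "algebraically_equivalent P Q \<longleftrightarrow> residue_class P = residue_class Q"


section \<open>Trees and the set \<open>P(T)\<close>\<close>

text \<open>\<open>Br t\<^sub>1 t\<^sub>2\<close> is \<open>[t\<^sub>1, t\<^sub>2]\<close>; \<open>Emp\<close> is the empty tree, so a leaf is \<open>Br Emp Emp\<close>.\<close>

datatype btree = Emp | Br btree btree

text \<open>A tagged tuple \<open>(t\<^sub>1, \<dots>, t\<^sub>k, \<tau>)\<close> is the pair \<open>([t\<^sub>1, \<dots>, t\<^sub>k], \<tau>)\<close>.\<close>

definition tuples :: "nat poly \<Rightarrow> (btree list \<times> nat) set" where
  "tuples P = {(ts, \<tau>). 1 \<le> \<tau> \<and> \<tau> \<le> coeff P (length ts)}"


section \<open>Patterns and substitutions\<close>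

text \<open>
  \<open>PLab l\<close> is a leaf labelled \<open>l\<close>, whereas \<open>PBr PEmp PEmp\<close> is an unlabelled leaf. Labels are drawn
  from \<open>nat\<close>, merely as an infinite supply of symbols.
\<close>

datatype pattern = PEmp | PBr pattern pattern | PLab nat

fun label_list :: "pattern \<Rightarrow> nat list" where
  "label_list PEmp = []"
| "label_list (PBr r s) = label_list r @ label_list s"
| "label_list (PLab l) = [l]"

definition tuple_label_list :: "pattern list \<times> nat \<Rightarrow> nat list" where
  "tuple_label_list p = concat (map label_list (fst p))"

definition labels :: "pattern list \<times> nat \<Rightarrow> nat set" where
  "labels p = set (tuple_label_list p)"

definition tuple_patterns :: "nat poly \<Rightarrow> (pattern list \<times> nat) set" where
  "tuple_patterns P =
    {(rs, \<tau>). 1 \<le> \<tau> \<and> \<tau> \<le> coeff P (length rs) \<and> distinct (tuple_label_list (rs, \<tau>))}"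

text \<open>
  A substitution is a partial map whose domain is exactly the set of labels of the pattern in
  question; a total function would make it unique only up to its values on irrelevant labels.
\<close>

definition substitution_for :: "pattern list \<times> nat \<Rightarrow> (nat \<rightharpoonup> btree) \<Rightarrow> bool" where
  "substitution_for p \<sigma> \<longleftrightarrow> dom \<sigma> = labels p"

fun pattern_instance :: "(nat \<rightharpoonup> btree) \<Rightarrow> pattern \<Rightarrow> btree" where
  "pattern_instance \<sigma> PEmp = Emp"
| "pattern_instance \<sigma> (PBr r s) = Br (pattern_instance \<sigma> r) (pattern_instance \<sigma> s)"
| "pattern_instance \<sigma> (PLab l) = the (\<sigma> l)"

definition tuple_instance :: "(nat \<rightharpoonup> btree) \<Rightarrow> pattern list \<times> nat \<Rightarrow> btree list \<times> nat" where
  "tuple_instance \<sigma> p = (map (pattern_instance \<sigma>) (fst p), snd p)"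


section \<open>Very explicit functions\<close>

text \<open>Only the values of \<open>f\<close> on \<open>P(T)\<close> are constrained.\<close>

definition very_explicit ::
  "nat poly \<Rightarrow> nat poly \<Rightarrow> (btree list \<times> nat \<Rightarrow> btree list \<times> nat) \<Rightarrow> bool" where
  "very_explicit P Q f \<longleftrightarrow>
    (\<exists>(I :: nat set) p q.
      finite I \<and>
      (\<forall>i\<in>I. p i \<in> tuple_patterns P \<and> q i \<in> tuple_patterns Q \<and> labels (p i) = labels (q i)) \<and>
      (\<forall>t\<in>tuples P. \<exists>!(i, \<sigma>). i \<in> I \<and> substitution_for (p i) \<sigma> \<and> t = tuple_instance \<sigma> (p i)) \<and>
      (\<forall>t\<in>tuples P. \<forall>i\<in>I. \<forall>\<sigma>. substitution_for (p i) \<sigma> \<and> t = tuple_instance \<sigma> (p i) \<longrightarrow>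
         f t = tuple_instance \<sigma> (q i)))"

definition combinatorially_equivalent :: "nat poly \<Rightarrow> nat poly \<Rightarrow> bool" where
  "combinatorially_equivalent P Q \<longleftrightarrow>
    (\<exists>f. very_explicit P Q f \<and> bij_betw f (tuples P) (tuples Q))"

end

theory Submission
  imports Defs "HOL-Library.Confluence"
begin

text \<open>
  A very explicit bijection amounts to two families of patterns over the same index set, one cutting
  \<open>P(T)\<close> and the other cutting \<open>Q(T)\<close> into disjoint sets of instances, such that corresponding
  patterns carry the same labels. So the question is which label counts occur in partitions of
  \<open>P(T)\<close>.

  From partitions to algebra: the label counts of a partition, read as a sum of monomials
  \<open>x\<^sup>n\<close>, have the same value in every commutative semiring with \<open>x = 1 + x\<^sup>2\<close>, whatever the
  partition (\<open>pattern_partitions_same_weight\<close>). The reason is that a pattern with \<open>n\<close> labels can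
  have its labels split again and again, each label \<open>x\<close> becoming an empty tree or a node with two
  labels, \<open>1 + x\<^sup>2\<close>, until all labels sit at a common depth \<open>d\<close>; and the partition of \<open>P(T)\<close>
  reached in this way no longer depends on where the splitting started. To avoid splitting
  explicitly, a pattern all of whose labels have depth \<open>d\<close> is represented by the tree obtained
  from it by erasing the labels. These are the trees of height at most \<open>d\<close>, and the number of
  labels is the number of empty subtrees at depth \<open>d\<close>. Summing \<open>x\<close> to this number over all
  tuples of such trees in \<open>P(T)\<close> gives one quantity that every partition of \<open>P(T)\<close> computes.
  Comparison with the partition into completely labelled tuples shows that it is the class of \<open>P\<close>.

  From algebra to partitions: the congruence is generated by splitting one monomial \<open>X\<^sup>k\<^sup>+\<^sup>1\<close> into
  \<open>X\<^sup>k + X\<^sup>k\<^sup>+\<^sup>2\<close>. Every monomial splits in at most one way and distinct monomials split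
  independently, so splitting is confluent, and congruent polynomials \<open>P\<close> and \<open>Q\<close> split into a
  common polynomial \<open>R\<close> (\<open>tree_cong_imp_common_splitting\<close>). Splitting a monomial is mirrored by
  splitting one label of a pattern, so both \<open>P(T)\<close> and \<open>Q(T)\<close> have partitions whose label counts
  are the exponents in \<open>R\<close> (\<open>standard_partition_if_splittable\<close>). Patterns with equal label counts
  are then matched. Passing through \<open>R\<close> makes it unnecessary to compose very explicit bijections.
\<close>

section \<open>Instances of patterns\<close>

definition instances :: "pattern list \<times> nat \<Rightarrow> (btree list \<times> nat) set" where
  "instances p = {tuple_instance \<sigma> p |\<sigma>. substitution_for p \<sigma>}"

lemma pattern_instance_eq_iff:
  "pattern_instance \<sigma> r = pattern_instance \<sigma>' r \<longleftrightarrow>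
    (\<forall>l\<in>set (label_list r). the (\<sigma> l) = the (\<sigma>' l))"
  by (induction r) auto

lemma tuple_instance_eq_iff:
  "tuple_instance \<sigma> p = tuple_instance \<sigma>' p \<longleftrightarrow> (\<forall>l\<in>labels p. the (\<sigma> l) = the (\<sigma>' l))"
  by (auto simp: tuple_instance_def labels_def tuple_label_list_def pattern_instance_eq_iff)

text \<open>
  Since the domain of a substitution is prescribed, a pattern and its instance determine the
  substitution. The uniqueness demanded of very explicit functions therefore concerns only the index
  of the pattern, which is all that \<open>pattern_partition\<close> below asks for.
\<close>

lemma tuple_instance_inject:
  assumes "substitution_for p \<sigma>" "substitution_for p \<sigma>'"
    and "tuple_instance \<sigma> p = tuple_instance \<sigma>' p"
  shows "\<sigma> = \<sigma>'"
proof
  fix l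
  show "\<sigma> l = \<sigma>' l"
  proof (cases "l \<in> labels p")
    case True
    then have "the (\<sigma> l) = the (\<sigma>' l)" "l \<in> dom \<sigma>" "l \<in> dom \<sigma>'"
      using assms by (auto simp: tuple_instance_eq_iff substitution_for_def)
    then show ?thesis by auto
  next
    case False
    then have "l \<notin> dom \<sigma>" "l \<notin> dom \<sigma>'"
      using assms by (auto simp: substitution_for_def)
    then show ?thesis by (simp add: domIff)
  qed
qed

text \<open>
  Freeing substitutions from the condition on their domain spares the construction of exact domains
  when substitutions are updated or merged.
\<close>

lemma instances_eq_range: "instances p = range (\<lambda>\<sigma>. tuple_instance \<sigma> p)"
proof -
  have "tuple_instance \<sigma> p \<in> instances p" for \<sigma>
  proof -
    define \<sigma>' where "\<sigma>' = (\<lambda>l. if l \<in> labels p then Some (the (\<sigma> l)) else None)"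
    have "tuple_instance \<sigma> p = tuple_instance \<sigma>' p"
      by (simp add: tuple_instance_eq_iff \<sigma>'_def)
    moreover have "substitution_for p \<sigma>'"
      by (auto simp: substitution_for_def \<sigma>'_def dom_def)
    ultimately show ?thesis by (auto simp: instances_def)
  qed
  then show ?thesis by (auto simp: instances_def)
qed

lemma tuple_instance_in_tuples: "p \<in> tuple_patterns P \<Longrightarrow> tuple_instance \<sigma> p \<in> tuples P"
  by (auto simp: tuple_patterns_def tuples_def tuple_instance_def)

definition pattern_partition :: "nat poly \<Rightarrow> 'i set \<Rightarrow> ('i \<Rightarrow> pattern list \<times> nat) \<Rightarrow> bool" where
  "pattern_partition P I p \<longleftrightarrow>
    finite I \<and> (\<forall>i\<in>I. p i \<in> tuple_patterns P) \<and>
    (\<forall>t\<in>tuples P. \<exists>!i. i \<in> I \<and> t \<in> instances (p i))"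

lemma pattern_partition_reindex:
  assumes "bij_betw g J I" and part: "pattern_partition P I p"
  shows "pattern_partition P J (p \<circ> g)"
proof -
  have inj: "inj_on g J" and img: "g ` J = I"
    using assms(1) by (auto simp: bij_betw_def)
  have "\<exists>!j. j \<in> J \<and> t \<in> instances ((p \<circ> g) j)" if t: "t \<in> tuples P" for t
  proof -
    obtain i where i: "i \<in> I" "t \<in> instances (p i)"
      and uniq: "\<And>i'. i' \<in> I \<Longrightarrow> t \<in> instances (p i') \<Longrightarrow> i' = i"
      using part t unfolding pattern_partition_def by metis
    obtain j where j: "j \<in> J" "g j = i" using i(1) img by auto
    show ?thesis
    proof (rule ex1I[of _ j])
      show "j \<in> J \<and> t \<in> instances ((p \<circ> g) j)" using i j by simp
      show "j' = j" if "j' \<in> J \<and> t \<in> instances ((p \<circ> g) j')" for j'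
        using that uniq[of "g j'"] img j inj by (auto simp: inj_on_def)
    qed
  qed
  moreover have "finite J"
    using part assms(1) bij_betw_finite unfolding pattern_partition_def by blast
  ultimately show ?thesis
    using part img unfolding pattern_partition_def by auto
qed

text \<open>
  The patterns \<open>q i\<close> inherit the partition property from the \<open>p i\<close>, because the bijection carries
  the instances of \<open>p i\<close> onto those of \<open>q i\<close>.
\<close>

lemma pattern_partitions_if_combinatorially_equivalent:
  assumes "combinatorially_equivalent P Q"
  shows "\<exists>(I :: nat set) p q. pattern_partition P I p \<and> pattern_partition Q I q \<and>
    (\<forall>i\<in>I. labels (p i) = labels (q i))"
proof -
  obtain f where "very_explicit P Q f" and bij: "bij_betw f (tuples P) (tuples Q)"
    using assms unfolding combinatorially_equivalent_def by (elim exE conjE)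
  from this(1) obtain I :: "nat set" and p q where fin: "finite I"
    and pat0: "\<forall>i\<in>I. p i \<in> tuple_patterns P \<and> q i \<in> tuple_patterns Q \<and> labels (p i) = labels (q i)"
    and uniq0: "\<forall>t\<in>tuples P.
      \<exists>!(i, \<sigma>). i \<in> I \<and> substitution_for (p i) \<sigma> \<and> t = tuple_instance \<sigma> (p i)"
    and f0: "\<forall>t\<in>tuples P. \<forall>i\<in>I. \<forall>\<sigma>. substitution_for (p i) \<sigma> \<and> t = tuple_instance \<sigma> (p i) \<longrightarrow>
      f t = tuple_instance \<sigma> (q i)"
    unfolding very_explicit_def by (elim exE conjE)
  have pat: "p i \<in> tuple_patterns P" "q i \<in> tuple_patterns Q" "labels (p i) = labels (q i)"
    if "i \<in> I" for i
    using pat0 that by blast+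
  note uniq = bspec[OF uniq0]
  have f: "f (tuple_instance \<sigma> (p i)) = tuple_instance \<sigma> (q i)"
    if "i \<in> I" "substitution_for (p i) \<sigma>" for i \<sigma>
    using f0[rule_format, OF tuple_instance_in_tuples[OF pat(1)[OF that(1)]] that(1), of \<sigma> \<sigma>] that(2)
    by blast
  have uniq': "\<exists>!i. i \<in> I \<and> t \<in> instances (p i)" if "t \<in> tuples P" for t
    using uniq[OF that] unfolding instances_def by auto
  have "\<exists>!i. i \<in> I \<and> u \<in> instances (q i)" if u: "u \<in> tuples Q" for u
  proof -
    have preimage: "\<exists>t\<in>tuples P. f t = u \<and> t \<in> instances (p i)"
      if i: "i \<in> I" and ui: "u \<in> instances (q i)" for i
    proof -
      obtain \<sigma> where \<sigma>: "substitution_for (q i) \<sigma>" "u = tuple_instance \<sigma> (q i)"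
        using ui by (auto simp: instances_def)
      have "substitution_for (p i) \<sigma>" using \<sigma> pat[OF i] by (simp add: substitution_for_def)
      then show ?thesis
        using f[OF i] \<sigma>(2) pat[OF i] tuple_instance_in_tuples unfolding instances_def by blast
    qed
    have "u \<in> f ` tuples P" using u by (simp only: bij_betw_imp_surj_on[OF bij])
    then obtain t where "u = f t" "t \<in> tuples P" by (rule imageE)
    then have t: "t \<in> tuples P" "f t = u" by simp_all
    obtain i \<sigma> where i: "i \<in> I" "substitution_for (p i) \<sigma>" "t = tuple_instance \<sigma> (p i)"
      using uniq[OF t(1)] by auto
    have "u = tuple_instance \<sigma> (q i)" using f[OF i(1,2)] i(3) t(2) by simp
    moreover have "substitution_for (q i) \<sigma>" using i pat[of i] by (simp add: substitution_for_def)
    ultimately have ui: "u \<in> instances (q i)" by (auto simp: instances_def)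
    show ?thesis
    proof (rule ex1I[of _ i])
      show "i \<in> I \<and> u \<in> instances (q i)" using ui i by simp
      fix j assume j: "j \<in> I \<and> u \<in> instances (q j)"
      obtain t' where t': "t' \<in> tuples P" "f t' = u" "t' \<in> instances (p j)" using preimage j by blast
      have "t' = t"
        by (rule inj_onD[OF bij_betw_imp_inj_on[OF bij]]) (simp_all only: t t')
      moreover have "t \<in> instances (p i)" using i by (auto simp: instances_def)
      ultimately show "j = i" using uniq'[OF t(1)] i j t' by blast
    qed
  qed
  then have "pattern_partition Q I q" using fin pat by (simp add: pattern_partition_def)
  moreover have "pattern_partition P I p" using fin pat uniq' by (simp add: pattern_partition_def)
  ultimately show ?thesis using pat by blast
qed

text \<open>
  The two partitions give bijections from the pairs of an index and a substitution onto \<open>P(T)\<close> and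
  onto \<open>Q(T)\<close>, and agreement of the labels makes both have the same domain. The very explicit
  bijection is one of them composed with the inverse of the other.
\<close>

lemma combinatorially_equivalent_if_pattern_partitions:
  fixes I :: "nat set"
  assumes P: "pattern_partition P I p" and Q: "pattern_partition Q I q"
    and lab: "\<And>i. i \<in> I \<Longrightarrow> labels (p i) = labels (q i)"
  shows "combinatorially_equivalent P Q"
proof -
  define rep where "rep t i \<sigma> \<longleftrightarrow> i \<in> I \<and> substitution_for (p i) \<sigma> \<and> t = tuple_instance \<sigma> (p i)"
    for t i \<sigma>
  have pat: "p i \<in> tuple_patterns P" "q i \<in> tuple_patterns Q" if "i \<in> I" for i
    using P Q that by (auto simp: pattern_partition_def)
  have sub: "substitution_for (p i) \<sigma> = substitution_for (q i) \<sigma>" if "i \<in> I" for i \<sigma>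
    using lab[OF that] by (simp add: substitution_for_def)
  have rep_ex: "\<exists>i \<sigma>. rep t i \<sigma>" if "t \<in> tuples P" for t
    using P that unfolding pattern_partition_def instances_def rep_def by blast
  have rep_unique: "i = j \<and> \<sigma> = \<sigma>'" if "rep t i \<sigma>" "rep t j \<sigma>'" for t i j \<sigma> \<sigma>'
  proof -
    have "t \<in> tuples P" using that pat tuple_instance_in_tuples by (auto simp: rep_def)
    then have "i = j"
      using P that unfolding pattern_partition_def instances_def rep_def by blast
    then show ?thesis using that tuple_instance_inject[of "p i" \<sigma> \<sigma>'] by (auto simp: rep_def)
  qed
  define f where "f t = (let (i, \<sigma>) = SOME (i, \<sigma>). rep t i \<sigma> in tuple_instance \<sigma> (q i))" for t
  have f: "f t = tuple_instance \<sigma> (q i)" if "rep t i \<sigma>" for t i \<sigma>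
  proof -
    have "(SOME (i, \<sigma>). rep t i \<sigma>) = (i, \<sigma>)"
      by (rule some_equality) (use that in \<open>auto dest: rep_unique[OF that]\<close>)
    then show ?thesis by (simp add: f_def)
  qed
  have "\<exists>!(i, \<sigma>). rep t i \<sigma>" if t: "t \<in> tuples P" for t
  proof -
    obtain i \<sigma> where "rep t i \<sigma>" using rep_ex[OF t] by blast
    then show ?thesis by (intro ex1I[of _ "(i, \<sigma>)"]) (auto dest: rep_unique[of t])
  qed
  then have "very_explicit P Q f"
    unfolding very_explicit_def
    using P lab pat f by (intro exI[of _ I] exI[of _ p] exI[of _ q])
      (auto simp: rep_def pattern_partition_def)
  moreover have "inj_on f (tuples P)"
  proof (rule inj_onI)
    fix t t' assume t: "t \<in> tuples P" "t' \<in> tuples P" and eq: "f t = f t'"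
    obtain i \<sigma> j \<sigma>' where r: "rep t i \<sigma>" "rep t' j \<sigma>'" using rep_ex t by meson
    then have ij: "i \<in> I" "j \<in> I" by (auto simp: rep_def)
    have u: "tuple_instance \<sigma> (q i) = tuple_instance \<sigma>' (q j)" using r f eq by simp
    have "tuple_instance \<sigma> (q i) \<in> tuples Q" using pat ij tuple_instance_in_tuples by blast
    moreover have "tuple_instance \<sigma> (q i) \<in> instances (q i)" by (simp add: instances_eq_range)
    moreover have "tuple_instance \<sigma> (q i) \<in> instances (q j)" by (simp add: u instances_eq_range)
    ultimately have "i = j" using Q ij unfolding pattern_partition_def by blast
    moreover have "\<sigma> = \<sigma>'"
      using tuple_instance_inject[of "q i" \<sigma> \<sigma>'] u r sub \<open>i = j\<close> by (auto simp: rep_def)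
    ultimately show "t = t'" using r by (simp add: rep_def)
  qed
  moreover have "f ` tuples P = tuples Q"
  proof (intro equalityI subsetI)
    fix u assume "u \<in> f ` tuples P"
    then obtain t i \<sigma> where "u = f t" "rep t i \<sigma>" using rep_ex by blast
    then show "u \<in> tuples Q" using f pat tuple_instance_in_tuples by (auto simp: rep_def)
  next
    fix u assume "u \<in> tuples Q"
    then obtain i \<sigma> where i: "i \<in> I" "substitution_for (q i) \<sigma>" "u = tuple_instance \<sigma> (q i)"
      using Q unfolding pattern_partition_def instances_def by blast
    then have "rep (tuple_instance \<sigma> (p i)) i \<sigma>" using sub by (simp add: rep_def)
    from f[OF this] show "u \<in> f ` tuples P"
      using i pat tuple_instance_in_tuples by (metis image_eqI)
  qed
  ultimately show ?thesis
    by (auto simp: combinatorially_equivalent_def bij_betw_def)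
qed


section \<open>The weight of a partition\<close>

text \<open>
  Trees of height at most \<open>d\<close>, where \<open>Emp\<close> has height \<open>0\<close>. Erasing labels turns the patterns all
  of whose labels have depth \<open>d\<close>, and all of whose other parts have smaller depth, into exactly
  these trees.
\<close>

fun bounded_trees :: "nat \<Rightarrow> btree set" where
  "bounded_trees 0 = {Emp}"
| "bounded_trees (Suc d) = insert Emp (case_prod Br ` (bounded_trees d \<times> bounded_trees d))"

text \<open>
  The number of empty subtrees at depth exactly \<open>d\<close> of a tree of height at most \<open>d\<close>, that is, the
  number of labels that were erased. An empty subtree at smaller depth stands for an unlabelled empty
  tree and does not count.
\<close>

fun frontier :: "nat \<Rightarrow> btree \<Rightarrow> nat" where
  "frontier 0 t = 1"
| "frontier (Suc d) Emp = 0"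
| "frontier (Suc d) (Br a b) = frontier d a + frontier d b"

text \<open>
  The least common depth to which the labels of a pattern can be pushed down by splitting so that all
  other parts of the pattern lie strictly above it. An unlabelled empty tree counts \<open>1\<close> because at
  depth \<open>d\<close> itself an empty subtree of a bounded tree stands for a label.
\<close>

fun depth :: "pattern \<Rightarrow> nat" where
  "depth PEmp = 1"
| "depth (PBr r s) = Suc (max (depth r) (depth s))"
| "depth (PLab l) = 0"

text \<open>
  The trees that a pattern with distinct labels has as instances. Being a product at every node, this
  set makes sums over instances factor.
\<close>

fun matching :: "pattern \<Rightarrow> btree set" where
  "matching PEmp = {Emp}"
| "matching (PBr r s) = case_prod Br ` (matching r \<times> matching s)"
| "matching (PLab l) = UNIV"

lemma finite_bounded_trees: "finite (bounded_trees d)"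
  by (induction d) auto

lemma inj_on_Br: "inj_on (case_prod Br) A"
  by (auto simp: inj_on_def)

lemma sum_Br:
  fixes x :: "'a :: comm_semiring_1"
  shows "(\<Sum>t\<in>case_prod Br ` (A \<times> B). x ^ frontier (Suc d) t) =
    (\<Sum>t\<in>A. x ^ frontier d t) * (\<Sum>t\<in>B. x ^ frontier d t)"
  by (subst sum.reindex[OF inj_on_Br])
    (simp add: sum_product sum.cartesian_product power_add case_prod_unfold)

text \<open>
  This is \<open>x = 1 + x\<^sup>2\<close> iterated \<open>d\<close> times: the bounded trees are what a single label splits into
  when it is pushed down to depth \<open>d\<close>.
\<close>

lemma sum_bounded_trees:
  fixes x :: "'a :: comm_semiring_1"
  assumes x: "x = 1 + x ^ 2"
  shows "(\<Sum>t\<in>bounded_trees d. x ^ frontier d t) = x"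
proof (induction d)
  case (Suc d)
  have "(\<Sum>t\<in>bounded_trees (Suc d). x ^ frontier (Suc d) t) =
      1 + (\<Sum>t\<in>case_prod Br ` (bounded_trees d \<times> bounded_trees d). x ^ frontier (Suc d) t)"
    unfolding bounded_trees.simps
    by (subst sum.insert) (auto simp: finite_bounded_trees)
  also have "\<dots> = 1 + x ^ 2" unfolding sum_Br Suc by (simp add: power2_eq_square)
  finally show ?case using x by simp
qed simp

text \<open>
  A label at depth \<open>c\<close> contributes a factor \<open>x\<close>, by \<open>sum_bounded_trees\<close> at \<open>d - c\<close>, and the
  unlabelled parts contribute \<open>1\<close> because they end above the frontier. For a smaller \<open>d\<close> this fails:
  \<open>PEmp\<close> at \<open>d = 0\<close> would contribute \<open>x\<close>.
\<close>

lemma sum_matching: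
  fixes x :: "'a :: comm_semiring_1"
  assumes x: "x = 1 + x ^ 2" and "depth r \<le> d"
  shows "(\<Sum>t\<in>matching r \<inter> bounded_trees d. x ^ frontier d t) = x ^ length (label_list r)"
  using assms(2)
proof (induction r arbitrary: d)
  case PEmp
  then obtain d' where d: "d = Suc d'" by (cases d) auto
  have "matching PEmp \<inter> bounded_trees d = {Emp}" by (auto simp: d)
  then show ?case by (simp add: d)
next
  case (PBr r s)
  then obtain d' where d: "d = Suc d'" by (cases d) auto
  have "matching (PBr r s) \<inter> bounded_trees d =
      case_prod Br ` ((matching r \<inter> bounded_trees d') \<times> (matching s \<inter> bounded_trees d'))"
    by (auto simp: d)
  then show ?case using PBr by (simp only: d sum_Br) (simp add: power_add)
next
  case (PLab l)
  then show ?case by (simp add: sum_bounded_trees[OF x])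
qed

definition matching_lists :: "pattern list \<Rightarrow> btree list set" where
  "matching_lists rs = {ts. list_all2 (\<lambda>t r. t \<in> matching r) ts rs}"

lemma sum_matching_lists:
  fixes x :: "'a :: comm_semiring_1"
  assumes x: "x = 1 + x ^ 2" and "\<forall>r\<in>set rs. depth r \<le> d"
  shows "(\<Sum>ts\<in>matching_lists rs \<inter> lists (bounded_trees d). x ^ sum_list (map (frontier d) ts)) =
    x ^ length (concat (map label_list rs))"
  using assms(2)
proof (induction rs)
  case Nil
  have "matching_lists [] \<inter> lists (bounded_trees d) = {[]}" by (auto simp: matching_lists_def)
  then show ?case by simp
next
  case (Cons r rs)
  have "matching_lists (r # rs) \<inter> lists (bounded_trees d) =
      case_prod (#) ` ((matching r \<inter> bounded_trees d) \<times> (matching_lists rs \<inter> lists (bounded_trees d)))"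
    (is "_ = _ ` ?A")
    by (auto simp: matching_lists_def list_all2_Cons2 image_iff)
  moreover have inj: "inj_on (case_prod (#)) ?A"
    by (auto simp: inj_on_def)
  ultimately have "(\<Sum>ts\<in>matching_lists (r # rs) \<inter> lists (bounded_trees d).
        x ^ sum_list (map (frontier d) ts)) =
      (\<Sum>t\<in>matching r \<inter> bounded_trees d. x ^ frontier d t) *
      (\<Sum>ts\<in>matching_lists rs \<inter> lists (bounded_trees d). x ^ sum_list (map (frontier d) ts))"
    by (simp only: sum.reindex[OF inj])
      (simp add: sum_product sum.cartesian_product power_add case_prod_unfold)
  then show ?case using Cons by (simp add: sum_matching[OF x] power_add)
qed

lemma pattern_instance_in_matching: "pattern_instance \<sigma> r \<in> matching r"
  by (induction r) auto

lemma pattern_instance_merge: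
  shows "set (label_list r) \<subseteq> A \<Longrightarrow>
      pattern_instance (\<lambda>l. if l \<in> A then \<sigma> l else \<sigma>' l) r = pattern_instance \<sigma> r"
    and "set (label_list r) \<inter> A = {} \<Longrightarrow>
      pattern_instance (\<lambda>l. if l \<in> A then \<sigma> l else \<sigma>' l) r = pattern_instance \<sigma>' r"
  by (auto simp: pattern_instance_eq_iff)

text \<open>
  Distinctness of the labels lets the substitutions found for the two subtrees be merged into one.
\<close>

lemma matching_imp_instance:
  assumes "distinct (label_list r)" "t \<in> matching r"
  shows "\<exists>\<sigma>. pattern_instance \<sigma> r = t"
  using assms
proof (induction r arbitrary: t)
  case (PBr r s)
  then obtain a b where t: "t = Br a b" "a \<in> matching r" "b \<in> matching s" by auto
  obtain \<sigma> \<sigma>' where "pattern_instance \<sigma> r = a" "pattern_instance \<sigma>' s = b"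
    using PBr t by fastforce
  moreover have "set (label_list s) \<inter> set (label_list r) = {}" using PBr.prems by auto
  ultimately show ?case
    using t
    by (intro exI[of _ "\<lambda>l. if l \<in> set (label_list r) then \<sigma> l else \<sigma>' l"])
      (simp add: pattern_instance_merge)
next
  case (PLab l)
  show ?case by (rule exI[of _ "\<lambda>_. Some t"]) simp
qed auto

lemma matching_lists_imp_instance:
  assumes "distinct (concat (map label_list rs))" "ts \<in> matching_lists rs"
  shows "\<exists>\<sigma>. map (pattern_instance \<sigma>) rs = ts"
  using assms
proof (induction rs arbitrary: ts)
  case (Cons r rs)
  then obtain t us where ts: "ts = t # us" "t \<in> matching r" "us \<in> matching_lists rs"
    by (auto simp: matching_lists_def list_all2_Cons2)
  obtain \<sigma> \<sigma>' where \<sigma>: "pattern_instance \<sigma> r = t" "map (pattern_instance \<sigma>') rs = us"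
    using Cons ts matching_imp_instance[of r t] by fastforce
  let ?\<tau> = "\<lambda>l. if l \<in> set (label_list r) then \<sigma> l else \<sigma>' l"
  have "pattern_instance ?\<tau> s = pattern_instance \<sigma>' s" if "s \<in> set rs" for s
    by (rule pattern_instance_merge(2)) (use Cons.prems that in auto)
  then show ?case
    using \<sigma> ts by (intro exI[of _ ?\<tau>]) (auto simp: pattern_instance_merge)
qed (simp add: matching_lists_def)

lemma instances_eq_matching_lists:
  assumes "distinct (tuple_label_list p)"
  shows "instances p = matching_lists (fst p) \<times> {snd p}"
proof -
  have "map (pattern_instance \<sigma>) rs \<in> matching_lists rs" for \<sigma> rs
    by (induction rs) (auto simp: matching_lists_def pattern_instance_in_matching)
  then show ?thesis
    using assms matching_lists_imp_instance[of "fst p"]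
    by (fastforce simp: instances_eq_range tuple_instance_def tuple_label_list_def image_iff)
qed

text \<open>
  The left-hand side mentions only \<open>P\<close> and \<open>d\<close>. Since the partition cuts \<open>P(T)\<close> into the instance
  sets of its patterns, the sum splits accordingly, each pattern contributing its monomial.
\<close>

lemma pattern_partition_weight:
  fixes x :: "'a :: comm_semiring_1"
  assumes x: "x = 1 + x ^ 2" and p: "pattern_partition P I p"
    and d: "\<forall>i\<in>I. \<forall>r\<in>set (fst (p i)). depth r \<le> d"
  shows "(\<Sum>(ts, \<tau>)\<in>tuples P \<inter> lists (bounded_trees d) \<times> UNIV. x ^ sum_list (map (frontier d) ts)) =
    (\<Sum>i\<in>I. x ^ card (labels (p i)))"
proof -
  let ?w = "\<lambda>(ts, \<tau> :: nat). x ^ sum_list (map (frontier d) ts)"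
  let ?B = "lists (bounded_trees d) \<times> (UNIV :: nat set)"
  have pat: "distinct (tuple_label_list (p i))" "instances (p i) \<subseteq> tuples P" if "i \<in> I" for i
    using p that tuple_instance_in_tuples
    by (auto simp: pattern_partition_def tuple_patterns_def instances_def)
  have inst: "instances (p i) \<inter> ?B =
      (matching_lists (fst (p i)) \<inter> lists (bounded_trees d)) \<times> {snd (p i)}" if "i \<in> I" for i
    using instances_eq_matching_lists[OF pat(1)[OF that]] by auto
  have fin: "finite (instances (p i) \<inter> ?B)" if "i \<in> I" for i
  proof -
    have "matching_lists (fst (p i)) \<inter> lists (bounded_trees d) \<subseteq>
        {ts. set ts \<subseteq> bounded_trees d \<and> length ts = length (fst (p i))}"
      by (auto simp: matching_lists_def list_all2_lengthD)
    then have "finite (matching_lists (fst (p i)) \<inter> lists (bounded_trees d))"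
      using finite_lists_length_eq[OF finite_bounded_trees] finite_subset by blast
    then show ?thesis using inst[OF that] by simp
  qed
  have "tuples P \<inter> ?B = (\<Union>i\<in>I. instances (p i) \<inter> ?B)"
    using p pat(2) unfolding pattern_partition_def by blast
  then have "sum ?w (tuples P \<inter> ?B) = (\<Sum>i\<in>I. sum ?w (instances (p i) \<inter> ?B))"
  proof (simp only:, intro sum.UNION_disjoint)
    show "finite I" using p by (simp add: pattern_partition_def)
    show "\<forall>i\<in>I. \<forall>j\<in>I. i \<noteq> j \<longrightarrow> (instances (p i) \<inter> ?B) \<inter> (instances (p j) \<inter> ?B) = {}"
      using p pat(2) unfolding pattern_partition_def by blast
  qed (use fin in blast)
  also have "\<dots> = (\<Sum>i\<in>I. x ^ card (labels (p i)))"
  proof (rule sum.cong)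
    fix i assume i: "i \<in> I"
    have "sum ?w (instances (p i) \<inter> ?B) =
        (\<Sum>ts\<in>matching_lists (fst (p i)) \<inter> lists (bounded_trees d). x ^ sum_list (map (frontier d) ts))"
      unfolding inst[OF i] by (simp flip: sum.cartesian_product)
    also have "\<dots> = x ^ length (tuple_label_list (p i))"
      using sum_matching_lists[OF x, of "fst (p i)" d] d i by (simp add: tuple_label_list_def)
    also have "length (tuple_label_list (p i)) = card (labels (p i))"
      using distinct_card[OF pat(1)[OF i]] by (simp add: labels_def)
    finally show "sum ?w (instances (p i) \<inter> ?B) = x ^ card (labels (p i))" .
  qed simp
  finally show ?thesis .
qed

lemma pattern_partitions_same_weight:
  fixes x :: "'a :: comm_semiring_1"
  assumes x: "x = 1 + x ^ 2" and p: "pattern_partition P I p" and q: "pattern_partition P J q"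
  shows "(\<Sum>i\<in>I. x ^ card (labels (p i))) = (\<Sum>j\<in>J. x ^ card (labels (q j)))"
proof -
  define D where "D = depth ` (\<Union>i\<in>I. set (fst (p i))) \<union> depth ` (\<Union>j\<in>J. set (fst (q j)))"
  have "finite D" using p q by (auto simp: D_def pattern_partition_def)
  then have "\<forall>n\<in>D. n \<le> Max D" by simp
  then have "\<forall>i\<in>I. \<forall>r\<in>set (fst (p i)). depth r \<le> Max D" "\<forall>j\<in>J. \<forall>r\<in>set (fst (q j)). depth r \<le> Max D"
    unfolding D_def by blast+
  then show ?thesis
    using pattern_partition_weight[OF x p] pattern_partition_weight[OF x q] by metis
qed


section \<open>The partition into completely labelled tuples\<close>

text \<open>
  Using an initial segment of the natural numbers as labels makes patterns with equally many labels
  have equal labels, so that no renaming is needed when two partitions are matched.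
\<close>

definition standard_partition ::
    "nat poly \<Rightarrow> nat set \<Rightarrow> (nat \<Rightarrow> pattern list \<times> nat) \<Rightarrow> (nat \<Rightarrow> nat) \<Rightarrow> nat poly \<Rightarrow> bool"
  where
  "standard_partition P I p n R \<longleftrightarrow> pattern_partition P I p \<and>
    (\<forall>i\<in>I. labels (p i) = {..<n i}) \<and> R = (\<Sum>i\<in>I. monom 1 (n i))"

text \<open>
  A monomial \<open>X\<^sup>k\<close> with coefficient \<open>c\<close> is turned into the \<open>c\<close> patterns that consist of \<open>k\<close> labels and
  one of the \<open>c\<close> tags.
\<close>

lemma trivial_partition: "\<exists>I p n. standard_partition P I p n P"
proof -
  define S where "S = (SIGMA k:{..degree P}. {1..coeff P k})"
  define p0 where "p0 = (\<lambda>(k, \<tau>). (map PLab [0..<k], \<tau> :: nat))"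
  have lab: "tuple_label_list (p0 (k, \<tau>)) = [0..<k]" for k \<tau>
  proof -
    have "concat (map label_list (map PLab xs)) = xs" for xs by (induction xs) auto
    then show ?thesis by (simp add: p0_def tuple_label_list_def)
  qed
  have S_iff: "(k, \<tau>) \<in> S \<longleftrightarrow> 1 \<le> \<tau> \<and> \<tau> \<le> coeff P k" for k \<tau>
    using le_degree[of P k] by (auto simp: S_def)
  have inst: "(ts, \<tau>) \<in> instances (p0 (k, \<tau>')) \<longleftrightarrow> k = length ts \<and> \<tau>' = \<tau>" for ts \<tau> k \<tau>'
    by (auto simp: instances_eq_matching_lists lab)
      (auto simp: matching_lists_def p0_def list_all2_conv_all_nth)
  have part: "pattern_partition P S p0"
    unfolding pattern_partition_def
  proof (intro conjI ballI)
    show "finite S" by (simp add: S_def)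
    show "p0 s \<in> tuple_patterns P" if "s \<in> S" for s
      using that lab[of "fst s" "snd s"] S_iff[of "fst s" "snd s"]
      by (auto simp: tuple_patterns_def p0_def case_prod_unfold)
    show "\<exists>!s. s \<in> S \<and> t \<in> instances (p0 s)" if "t \<in> tuples P" for t
      using that by (cases t, intro ex1I[of _ "(length (fst t), snd t)"])
        (auto simp: tuples_def S_iff inst)
  qed
  have card: "labels (p0 (k, \<tau>)) = {..<k}" for k \<tau>
    by (simp add: labels_def lab atLeast0LessThan)
  have "P = (\<Sum>k\<le>degree P. monom (coeff P k) k)" by (simp add: poly_as_sum_of_monoms)
  also have "\<dots> = (\<Sum>k\<le>degree P. \<Sum>\<tau>\<in>{1..coeff P k}. monom 1 k)"
    by (simp add: of_nat_poly smult_monom del: One_nat_def)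
  also have "\<dots> = (\<Sum>(k, \<tau>)\<in>S. monom 1 k)"
    unfolding S_def by (rule sum.Sigma) simp_all
  finally have P: "P = (\<Sum>(k, \<tau>)\<in>S. monom 1 k)" .
  obtain e where e: "bij_betw e {0..<card S} S"
    using ex_bij_betw_nat_finite[of S] part by (auto simp: pattern_partition_def)
  have "standard_partition P {0..<card S} (p0 \<circ> e) (fst \<circ> e) P"
    unfolding standard_partition_def
  proof (intro conjI ballI)
    show "pattern_partition P {0..<card S} (p0 \<circ> e)"
      by (rule pattern_partition_reindex[OF e part])
    show "labels ((p0 \<circ> e) i) = {..<(fst \<circ> e) i}" for i
      using card by (cases "e i") simp
    show "P = (\<Sum>i\<in>{0..<card S}. monom 1 ((fst \<circ> e) i))"
      using sum.reindex_bij_betw[OF e, of "\<lambda>s. monom (1 :: nat) (fst s)"] P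
      by (simp add: case_prod_unfold)
  qed
  then show ?thesis by blast
qed


section \<open>Splitting a monomial\<close>

inductive split_step :: "nat poly \<Rightarrow> nat poly \<Rightarrow> bool" where
  "split_step (R + monom 1 (Suc k)) (R + (monom 1 k + monom 1 (k + 2)))"

lemma split_step_add: "split_step R S \<Longrightarrow> split_step (R + U) (S + U)"
proof (induction rule: split_step.induct)
  case (1 R k)
  show ?case using split_step.intros[of "R + U" k] by (simp add: ac_simps)
qed

lemma equivclp_split_step_add:
  assumes "equivclp split_step R S" "equivclp split_step U V"
  shows "equivclp split_step (R + U) (S + V)"
proof -
  have right: "equivclp split_step (A + C) (B + C)" if "equivclp split_step A B" for A B C
    using that
  proof (induction rule: equivclp_induct)
    case (step B B')
    then have "split_step (B + C) (B' + C) \<or> split_step (B' + C) (B + C)"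
      using split_step_add by blast
    then show ?case using step.IH by (blast intro: equivclp_into_equivclp)
  qed simp
  have "equivclp split_step (R + U) (S + U)" using assms right by blast
  also have "equivclp split_step (S + U) (S + V)"
    using right[OF assms(2), of S] by (simp add: add.commute)
  finally show ?thesis .
qed

text \<open>
  Splitting is compatible with multiplication because \<open>X\<^sup>k\<^sup>+\<^sup>1 X\<^sup>m\<close> splits into
  \<open>X\<^sup>k X\<^sup>m + X\<^sup>k\<^sup>+\<^sup>2 X\<^sup>m\<close> for every monomial \<open>X\<^sup>m\<close> of the other factor. The recursion over the
  coefficients of that factor moves each power of \<open>X\<close> over to the left.
\<close>

lemma equivclp_split_step_monom_mult:
  "equivclp split_step (monom 1 (Suc k) * U) ((monom 1 k + monom 1 (k + 2)) * U)"
proof (induction U arbitrary: k rule: pCons_induct)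
  case (pCons a U)
  have gen: "equivclp split_step (monom 1 (Suc k)) (monom 1 k + monom 1 (k + 2))"
    using split_step.intros[of 0 k] by (simp add: r_into_equivclp)
  have const: "equivclp split_step (monom 1 (Suc k) * [:a:]) ((monom 1 k + monom 1 (k + 2)) * [:a:])"
  proof (induction a)
    case (Suc a)
    have "[:Suc a:] = 1 + [:a:]" by (simp add: one_pCons)
    then show ?case using equivclp_split_step_add[OF gen Suc] by (simp only: ring_distribs mult_1_right)
  qed simp
  have shift: "monom 1 j * pCons a U = monom 1 j * [:a:] + monom 1 (Suc j) * U" for j
  proof -
    have "pCons a U = [:a:] + [:0, 1:] * U" by (simp del: One_nat_def)
    moreover have "monom 1 j * [:0, 1:] = (monom 1 (Suc j) :: nat poly)"
      using mult_monom[of 1 j "1::nat" 1] by (simp add: monom_altdef)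
    ultimately show ?thesis by (simp only: distrib_left mult.assoc[symmetric])
  qed
  then show ?case
    using equivclp_split_step_add[OF const pCons.IH[of "Suc k"]]
    by (simp only: shift distrib_right add_Suc add.assoc add.commute add.left_commute)
qed simp

lemma equivclp_split_step_mult:
  assumes "equivclp split_step R S" "equivclp split_step U V"
  shows "equivclp split_step (R * U) (S * V)"
proof -
  have split: "equivclp split_step (A * C) (B * C)" if "split_step A B" for A B C
    using that
  proof cases
    case (1 R k)
    show ?thesis
      unfolding 1 distrib_right[of R _ C]
      by (intro equivclp_split_step_add equivclp_refl equivclp_split_step_monom_mult)
  qed
  have right: "equivclp split_step (A * C) (B * C)" if "equivclp split_step A B" for A B C
    using that
  proof (induction rule: equivclp_induct)
    case (step B B')
    then have "equivclp split_step (B * C) (B' * C)"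
      using split equivclp_sym by metis
    with step.IH show ?case by (rule equivclp_trans)
  qed simp
  have "equivclp split_step (R * U) (S * U)" using assms right by blast
  also have "equivclp split_step (S * U) (S * V)"
    using right[OF assms(2), of S] by (simp add: mult.commute)
  finally show ?thesis .
qed

lemma tree_cong_imp_equivclp_split_step: "tree_cong P Q \<Longrightarrow> equivclp split_step P Q"
proof (induction rule: tree_cong.induct)
  case gen
  have "[:0, 1:] = (0 + monom 1 (Suc 0) :: nat poly)" by (simp add: monom_Suc monom_0)
  moreover have "1 + [:0, 1:]\<^sup>2 = (0 + (monom 1 0 + monom 1 (0 + 2)) :: nat poly)"
    by (simp add: power2_eq_square one_pCons monom_Suc monom_0 numeral_2_eq_2)
  ultimately show ?case
    using split_step.intros[of 0 0] r_into_equivclp[of split_step] by metis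
next
  case (sym p q)
  from sym.IH show ?case by (rule equivclp_sym)
next
  case (trans p q r)
  then show ?case by (blast intro: equivclp_trans)
qed (simp_all add: equivclp_split_step_add equivclp_split_step_mult)

text \<open>
  Two steps from the same polynomial either split the same monomial, with the same result, or split
  different monomials, and then each remains possible after the other.
\<close>

lemma strong_confluentp_split_step: "strong_confluentp split_step"
proof
  fix A B C assume "split_step A B" "split_step A C"
  then obtain R k S j where
    k: "A = R + monom 1 (Suc k)" "B = R + (monom 1 k + monom 1 (k + 2))" and
    j: "A = S + monom 1 (Suc j)" "C = S + (monom 1 j + monom 1 (j + 2))"
    by (elim split_step.cases) blast
  show "\<exists>u. split_step\<^sup>*\<^sup>* B u \<and> split_step\<^sup>=\<^sup>= C u"
  proof (cases "k = j")
    case True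
    then show ?thesis using k j by auto
  next
    case False
    define U where "U = R - monom 1 (Suc j)"
    \<comment> \<open>Both redexes are present in \<open>A\<close> and differ, so \<open>A = U + X\<^sup>k\<^sup>+\<^sup>1 + X\<^sup>j\<^sup>+\<^sup>1\<close>.\<close>
    have "coeff (R + monom 1 (Suc k)) (Suc j) = coeff (S + monom 1 (Suc j)) (Suc j)" using k j by simp
    then have "coeff R (Suc j) \<ge> 1" using False by simp
    then have R: "R = U + monom 1 (Suc j)" by (auto simp: U_def poly_eq_iff)
    then have "S + monom 1 (Suc j) = (U + monom 1 (Suc k)) + monom 1 (Suc j)"
      using k j by (simp add: ac_simps)
    then have S: "S = U + monom 1 (Suc k)" by (rule add_right_imp_eq)
    let ?D = "U + (monom 1 k + monom 1 (k + 2)) + (monom 1 j + monom 1 (j + 2))"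
    have "split_step B ?D"
      using split_step.intros[of "U + (monom 1 k + monom 1 (k + 2))" j] by (simp add: k R ac_simps)
    moreover have "split_step C ?D"
      using split_step.intros[of "U + (monom 1 j + monom 1 (j + 2))" k] by (simp add: j S ac_simps)
    ultimately show ?thesis by auto
  qed
qed

lemma tree_cong_imp_common_splitting:
  assumes "tree_cong P Q"
  shows "\<exists>R. split_step\<^sup>*\<^sup>* P R \<and> split_step\<^sup>*\<^sup>* Q R"
  using tree_cong_imp_equivclp_split_step[OF assms]
    semiconfluentp_equivclp[OF strong_confluentp_into_semiconfluentp[OF strong_confluentp_split_step]]
  by (auto simp: rtranclp_conversep)


section \<open>Splitting a pattern\<close>

fun subst_label :: "nat \<Rightarrow> pattern \<Rightarrow> pattern \<Rightarrow> pattern" where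
  "subst_label k r PEmp = PEmp"
| "subst_label k r (PBr s s') = PBr (subst_label k r s) (subst_label k r s')"
| "subst_label k r (PLab l) = (if l = k then r else PLab l)"

definition subst_label_tuple ::
    "nat \<Rightarrow> pattern \<Rightarrow> pattern list \<times> nat \<Rightarrow> pattern list \<times> nat" where
  "subst_label_tuple k r p = (map (subst_label k r) (fst p), snd p)"

lemma label_list_subst_label:
  "label_list (subst_label k r s) =
    concat (map (\<lambda>l. if l = k then label_list r else [l]) (label_list s))"
  by (induction s) auto

lemma tuple_label_list_subst_label_tuple:
  "tuple_label_list (subst_label_tuple k r p) =
    concat (map (\<lambda>l. if l = k then label_list r else [l]) (tuple_label_list p))"
proof -
  have "concat (map label_list (map (subst_label k r) rs)) =
      concat (map (\<lambda>l. if l = k then label_list r else [l]) (concat (map label_list rs)))" for rs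
    by (induction rs) (simp_all add: label_list_subst_label)
  then show ?thesis by (simp add: subst_label_tuple_def tuple_label_list_def)
qed

lemma labels_subst_label_tuple:
  assumes "k \<in> labels p"
  shows "labels (subst_label_tuple k r p) = set (label_list r) \<union> (labels p - {k})"
  using assms by (auto simp: labels_def tuple_label_list_subst_label_tuple split: if_splits)

lemma subst_label_tuple_in_tuple_patterns:
  assumes "p \<in> tuple_patterns P" "distinct (label_list r)"
    and "set (label_list r) \<inter> (labels p - {k}) = {}"
  shows "subst_label_tuple k r p \<in> tuple_patterns P"
proof -
  have "distinct (concat (map (\<lambda>l. if l = k then ys else [l]) xs))"
    if "distinct xs" "distinct ys" "set ys \<inter> (set xs - {k}) = {}" for xs ys :: "nat list"
    using that by (induction xs) (auto split: if_splits)
  then have "distinct (tuple_label_list (subst_label_tuple k r p))"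
    using assms by (auto simp: tuple_label_list_subst_label_tuple labels_def tuple_patterns_def)
  then show ?thesis
    using assms(1) by (auto simp: tuple_patterns_def subst_label_tuple_def)
qed

lemma tuple_instance_subst_label_tuple:
  "tuple_instance \<sigma> (subst_label_tuple k r p) =
    tuple_instance (\<sigma>(k \<mapsto> pattern_instance \<sigma> r)) p"
proof -
  have "pattern_instance \<sigma> (subst_label k r s) = pattern_instance (\<sigma>(k \<mapsto> pattern_instance \<sigma> r)) s" for s
    by (induction s) auto
  then show ?thesis by (simp add: tuple_instance_def subst_label_tuple_def)
qed

text \<open>
  The instances of a pattern are sorted by whether the label \<open>k\<close> receives the empty tree or a tree
  \<open>[a, b]\<close>. In the second case \<open>k\<close> is reused for \<open>a\<close>, and the new label \<open>k'\<close> stands for \<open>b\<close>.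
\<close>

lemma instances_split:
  assumes k: "k \<in> labels p" and k': "k' \<notin> labels p"
  defines "p0 \<equiv> subst_label_tuple k PEmp p"
    and "p1 \<equiv> subst_label_tuple k (PBr (PLab k) (PLab k')) p"
  shows "instances p = instances p0 \<union> instances p1" and "instances p0 \<inter> instances p1 = {}"
proof -
  have p0: "tuple_instance \<sigma> p0 = tuple_instance (\<sigma>(k \<mapsto> Emp)) p"
    and p1: "tuple_instance \<sigma> p1 = tuple_instance (\<sigma>(k \<mapsto> Br (the (\<sigma> k)) (the (\<sigma> k')))) p" for \<sigma>
    by (simp_all add: p0_def p1_def tuple_instance_subst_label_tuple)
  show "instances p0 \<inter> instances p1 = {}"
    using k by (fastforce simp: instances_eq_range p0 p1 tuple_instance_eq_iff)
  have "tuple_instance \<sigma> p \<in> instances p0 \<union> instances p1" for \<sigma>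
  proof (cases "the (\<sigma> k)")
    case Emp
    then have "tuple_instance \<sigma> p = tuple_instance \<sigma> p0"
      by (simp add: p0 tuple_instance_eq_iff)
    then show ?thesis by (auto simp: instances_eq_range)
  next
    case (Br a b)
    then have "tuple_instance \<sigma> p = tuple_instance (\<sigma>(k \<mapsto> a, k' \<mapsto> b)) p1"
      using k k' by (auto simp: p1 tuple_instance_eq_iff)
    then show ?thesis by (auto simp: instances_eq_range)
  qed
  then show "instances p = instances p0 \<union> instances p1"
    unfolding instances_eq_range p0 p1 by blast
qed

text \<open>
  A monomial \<open>X\<^sup>k\<^sup>+\<^sup>1\<close> of \<open>R\<close> belongs to a pattern with labels \<open>0, \<dots>, k\<close>. Splitting the largest one,
  \<open>k\<close>, leaves the labels \<open>0, \<dots>, k - 1\<close> in one part and \<open>0, \<dots>, k + 1\<close> in the other, so both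
  parts again have an initial segment as labels.
\<close>

lemma standard_partition_split_step:
  assumes part: "standard_partition P I p n R" and "split_step R S"
  shows "\<exists>J q m. standard_partition P J q m S"
proof -
  obtain U k where R: "R = U + monom 1 (Suc k)" and S: "S = U + (monom 1 k + monom 1 (k + 2))"
    using assms(2) by (auto elim: split_step.cases)
  have fin: "finite I" and pat: "\<And>i. i \<in> I \<Longrightarrow> p i \<in> tuple_patterns P"
    and ex1: "\<And>t. t \<in> tuples P \<Longrightarrow> \<exists>!i. i \<in> I \<and> t \<in> instances (p i)"
    and lab: "\<And>i. i \<in> I \<Longrightarrow> labels (p i) = {..<n i}"
    and sum: "R = (\<Sum>i\<in>I. monom 1 (n i))"
    using part by (auto simp: standard_partition_def pattern_partition_def)
  have "coeff (\<Sum>i\<in>I. monom 1 (n i)) (Suc k) \<noteq> (0 :: nat)"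
    using R sum by (metis add_is_0 coeff_add coeff_monom one_neq_zero)
  then obtain i where i: "i \<in> I" "n i = Suc k"
    using fin by (auto simp: coeff_sum split: if_splits)
  have labi: "labels (p i) = {..<Suc k}" using lab[OF i(1)] i(2) by simp
  obtain j where j: "j \<notin> I" using ex_new_if_finite[OF infinite_UNIV_nat fin] by blast
  define p0 where "p0 = subst_label_tuple k PEmp (p i)"
  define p1 where "p1 = subst_label_tuple k (PBr (PLab k) (PLab (Suc k))) (p i)"
  define q where "q = p(i := p0, j := p1)"
  define m where "m = n(i := k, j := k + 2)"
  have q: "q i = p0" "q j = p1" "\<And>l. l \<in> I - {i} \<Longrightarrow> q l = p l" using i j by (auto simp: q_def)
  have m: "m i = k" "m j = k + 2" "\<And>l. l \<in> I - {i} \<Longrightarrow> m l = n l" using i j by (auto simp: m_def)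
  have k: "k \<in> labels (p i)" "Suc k \<notin> labels (p i)" by (simp_all add: labi)
  have lab0: "labels p0 = {..<k}"
    unfolding p0_def labels_subst_label_tuple[OF k(1)] labi by auto
  have lab1: "labels p1 = {..<k + 2}"
    unfolding p1_def labels_subst_label_tuple[OF k(1)] labi by auto
  have pat': "p0 \<in> tuple_patterns P" "p1 \<in> tuple_patterns P"
    unfolding p0_def p1_def
    by (rule subst_label_tuple_in_tuple_patterns[OF pat[OF i(1)]]; simp add: labi)+
  have inst: "instances (p i) = instances p0 \<union> instances p1" "instances p0 \<inter> instances p1 = {}"
    unfolding p0_def p1_def by (rule instances_split[OF k])+
  have "\<exists>!l. l \<in> insert j I \<and> t \<in> instances (q l)" if t: "t \<in> tuples P" for t
  proof -
    obtain c where c: "c \<in> I" "t \<in> instances (p c)"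
      and uniq: "\<And>l. l \<in> I \<Longrightarrow> t \<in> instances (p l) \<Longrightarrow> l = c" using ex1[OF t] by metis
    define c' where "c' = (if c = i then if t \<in> instances p0 then i else j else c)"
    show ?thesis
    proof (rule ex1I[of _ c'])
      show "c' \<in> insert j I \<and> t \<in> instances (q c')"
        using c i inst q by (auto simp: c'_def)
      fix l assume l: "l \<in> insert j I \<and> t \<in> instances (q l)"
      consider "l = j" | "l = i" | "l \<in> I - {i}" using l by blast
      then show "l = c'"
      proof cases
        case 1
        then have "t \<in> instances (p i)" "t \<notin> instances p0" using l inst q by auto
        then show ?thesis using 1 uniq[OF i(1)] by (simp add: c'_def)
      next
        case 2
        then have "t \<in> instances (p i)" "t \<in> instances p0" using l inst q by auto
        then show ?thesis using 2 uniq[OF i(1)] by (simp add: c'_def)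
      next
        case 3
        then have "l = c" using l q(3)[of l] uniq[of l] by simp
        then show ?thesis using 3 by (simp add: c'_def)
      qed
    qed
  qed
  then have "pattern_partition P (insert j I) q"
    using fin pat pat' q i by (auto simp: pattern_partition_def q_def)
  moreover have "labels (q l) = {..<m l}" if "l \<in> insert j I" for l
  proof (cases "l \<in> I - {i}")
    case True
    then show ?thesis using lab[of l] q(3)[of l] m(3)[of l] by simp
  next
    case False
    then have "l = i \<or> l = j" using that by blast
    then show ?thesis using q m lab0 lab1 by fastforce
  qed
  moreover have "S = (\<Sum>l\<in>insert j I. monom 1 (m l))"
  proof -
    have "R = monom 1 (Suc k) + (\<Sum>l\<in>I - {i}. monom 1 (n l))"
      using sum.remove[OF fin i(1), of "\<lambda>l. monom (1 :: nat) (n l)"] sum i(2) by simp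
    then have "U + monom 1 (Suc k) = (\<Sum>l\<in>I - {i}. monom 1 (n l)) + monom 1 (Suc k)"
      using R by (simp only: add.commute)
    then have U: "U = (\<Sum>l\<in>I - {i}. monom 1 (n l))" by (rule add_right_imp_eq)
    have "(\<Sum>l\<in>insert j I. monom 1 (m l)) =
        monom 1 (k + 2) + (monom 1 k + (\<Sum>l\<in>I - {i}. monom 1 (m l)))"
      using fin i j by (simp add: m sum.remove[of I i])
    also have "(\<Sum>l\<in>I - {i}. monom 1 (m l)) = U"
      unfolding U using m by (intro sum.cong) auto
    finally show ?thesis by (simp add: S ac_simps)
  qed
  ultimately show ?thesis unfolding standard_partition_def by blast
qed

lemma standard_partition_if_splittable:
  assumes "split_step\<^sup>*\<^sup>* P R"
  shows "\<exists>I p n. standard_partition P I p n R"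
  using assms
  by (induction rule: rtranclp_induct) (use trivial_partition standard_partition_split_step in blast)+


section \<open>The two equivalences agree\<close>

text \<open>
  The coefficient at \<open>k\<close> counts the indices with exponent \<open>k\<close>, so the fibres of \<open>m\<close> and \<open>n\<close> have equal
  size and can be matched one by one.
\<close>

lemma bij_betw_if_equal_monom_sums:
  fixes m :: "'a \<Rightarrow> nat" and n :: "'b \<Rightarrow> nat"
  assumes "finite I" "finite J" and eq: "(\<Sum>i\<in>I. monom (1::nat) (m i)) = (\<Sum>j\<in>J. monom 1 (n j))"
  shows "\<exists>g. bij_betw g I J \<and> (\<forall>i\<in>I. n (g i) = m i)"
proof -
  have coeff: "coeff (\<Sum>i\<in>A. monom (1::nat) (f i)) k = card {i \<in> A. f i = k}"
    if "finite A" for A :: "'c set" and f k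
    using that by (simp add: coeff_sum sum.If_cases Int_def)
  have "\<exists>h. bij_betw h {i \<in> I. m i = k} {j \<in> J. n j = k}" for k
    using assms coeff[of I m k] coeff[of J n k] by (intro finite_same_card_bij) auto
  then obtain h where h: "\<And>k. bij_betw (h k) {i \<in> I. m i = k} {j \<in> J. n j = k}" by metis
  define g where "g i = h (m i) i" for i
  have g: "g i \<in> J" "n (g i) = m i" if "i \<in> I" for i
    using bij_betwE[OF h[of "m i"]] that by (auto simp: g_def)
  have "inj_on g I"
  proof (rule inj_onI)
    fix i i' assume i: "i \<in> I" "i' \<in> I" "g i = g i'"
    then have "m i = m i'" using g by metis
    then show "i = i'" using h[of "m i"] i by (auto simp: g_def bij_betw_def inj_on_def)
  qed
  moreover have "J \<subseteq> g ` I"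
  proof
    fix j assume "j \<in> J"
    then have "j \<in> h (n j) ` {i \<in> I. m i = n j}"
      unfolding bij_betw_imp_surj_on[OF h[of "n j"]] by blast
    then obtain i where i: "j = h (n j) i" "i \<in> {i \<in> I. m i = n j}" by (rule imageE)
    have "m i = n j" "i \<in> I" using i(2) by simp_all
    have "j = g i" unfolding g_def \<open>m i = n j\<close> by (rule i(1))
    then show "j \<in> g ` I" using \<open>i \<in> I\<close> by (rule image_eqI)
  qed
  ultimately show ?thesis using g by (auto simp: bij_betw_def)
qed

lemma residue_class_sum_monom:
  "residue_class (\<Sum>i\<in>I. monom 1 (n i)) = (\<Sum>i\<in>I. residue_class [:0, 1:] ^ n i)"
proof -
  have "residue_class (monom 1 k) = residue_class [:0, 1:] ^ k" for k
  proof (induction k)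
    case 0
    show ?case by (simp only: monom_eq_1 residue_class_hom power_0)
  next
    case (Suc k)
    have "monom 1 (Suc k) = [:0, 1:] * (monom 1 k :: nat poly)"
      by (simp add: monom_Suc del: One_nat_def)
    then show ?case by (simp only: residue_class_hom Suc power_Suc)
  qed
  then show ?thesis
    by (induction I rule: infinite_finite_induct) (simp_all add: residue_class_hom del: One_nat_def)
qed

text \<open>
  The claim is evident for the partition into completely labelled tuples, and the weight does not
  depend on the partition.
\<close>

lemma residue_class_eq_partition_weight:
  assumes "pattern_partition P I p"
  shows "residue_class P = (\<Sum>i\<in>I. residue_class [:0, 1:] ^ card (labels (p i)))"
proof -
  let ?x = "residue_class [:0, 1:]"
  have "?x = residue_class (1 + [:0, 1:]\<^sup>2)"
    unfolding residue_class_def tree_semiring.abs_eq_iff by (rule tree_cong.gen)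
  then have x: "?x = 1 + ?x ^ 2" unfolding power2_eq_square residue_class_hom .
  obtain J q n where "standard_partition P J q n P" using trivial_partition by blast
  then have J: "pattern_partition P J q" and lab: "\<And>j. j \<in> J \<Longrightarrow> labels (q j) = {..<n j}"
    and P: "P = (\<Sum>j\<in>J. monom 1 (n j))"
    by (auto simp: standard_partition_def)
  have "residue_class P = residue_class (\<Sum>j\<in>J. monom 1 (n j))" using P by (rule arg_cong)
  also have "\<dots> = (\<Sum>j\<in>J. ?x ^ n j)"
    by (rule residue_class_sum_monom)
  also have "\<dots> = (\<Sum>j\<in>J. ?x ^ card (labels (q j)))" using lab by simp
  also have "\<dots> = (\<Sum>i\<in>I. ?x ^ card (labels (p i)))"
    by (rule pattern_partitions_same_weight[OF x J assms])
  finally show ?thesis .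
qed

theorem theorem3:
  fixes P Q :: "nat poly"
  shows "combinatorially_equivalent P Q \<longleftrightarrow> algebraically_equivalent P Q"
proof
  assume "combinatorially_equivalent P Q"
  then obtain I :: "nat set" and p q where
    "pattern_partition P I p" "pattern_partition Q I q" "\<forall>i\<in>I. labels (p i) = labels (q i)"
    using pattern_partitions_if_combinatorially_equivalent by blast
  then show "algebraically_equivalent P Q"
    unfolding algebraically_equivalent_def by (simp add: residue_class_eq_partition_weight)
next
  assume "algebraically_equivalent P Q"
  then have "tree_cong P Q"
    by (simp add: algebraically_equivalent_def residue_class_def tree_semiring.abs_eq_iff)
  then obtain R where "split_step\<^sup>*\<^sup>* P R" "split_step\<^sup>*\<^sup>* Q R"
    using tree_cong_imp_common_splitting by blast
  then obtain I p m J q n where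
    "standard_partition P I p m R" and "standard_partition Q J q n R"
    using standard_partition_if_splittable by metis
  then have P: "pattern_partition P I p" "\<And>i. i \<in> I \<Longrightarrow> labels (p i) = {..<m i}"
    and Q: "pattern_partition Q J q" "\<And>j. j \<in> J \<Longrightarrow> labels (q j) = {..<n j}"
    and sums: "(\<Sum>i\<in>I. monom (1 :: nat) (m i)) = (\<Sum>j\<in>J. monom 1 (n j))"
    by (auto simp: standard_partition_def)
  have "finite I" "finite J" using P(1) Q(1) by (simp_all add: pattern_partition_def)
  then obtain g where g: "bij_betw g I J" "\<forall>i\<in>I. n (g i) = m i"
    using bij_betw_if_equal_monom_sums sums by blast
  have "pattern_partition Q I (q \<circ> g)" by (rule pattern_partition_reindex[OF g(1) Q(1)])
  moreover have "labels (p i) = labels ((q \<circ> g) i)" if "i \<in> I" for i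
    using that P(2) Q(2) g bij_betwE[OF g(1)] by simp
  ultimately show "combinatorially_equivalent P Q"
    using P(1) combinatorially_equivalent_if_pattern_partitions by blast
qed

end
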